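(* Let $N\ge2$ and $d\ge1$ be integers. Let $f:\mathbb{Z}_N^d\to\mathbb{C}$ be a nonzero function supported in $E\subset\mathbb{Z}_N^d$, with $\widehat f$ supported in $S\subset\mathbb{Z}_N^d$. Suppose that $S$ is a disjoint union of sets $S_i$, $1\le i\le n$. Then $$|E|\cdot n^3\cdot\sum_{i=1}^n\Lambda(S_i)\ge N^d.$$ Similarly, if $E$ is a disjoint union of sets $E_i$, $1\le i\le m$, then $$|S|\cdot m^3\cdot\sum_{i=1}^m\Lambda(E_i)\ge N^d.$$
   Context: $\mathbb{Z}_N=\mathbb{Z}/N\mathbb{Z}$, and $\chi(t)=e^{2\pi i t/N}$ for $t\in\mathbb{Z}_N$. The discrete Fourier transform of $f:\mathbb{Z}_N^d\to\mathbb{C}$ is $\widehat f(m)=N^{-d}\sum_{x\in\mathbb{Z}_N^d}\chi(-x\cdot m)f(x)$. "Supported in $E$" means the function vanishes outside $E$. For $A\subset\mathbb{Z}_N^d$, the additive energy is $\Lambda(A)=|\{(x_1,x_2,x_3,x_4)\in A^4: x_1+x_2=x_3+x_4\}|$. *)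

theory Defs
  imports Complex_Main "HOL-Library.FuncSet" "HOL-Library.Disjoint_Sets"
    "HOL-Number_Theory.Residues"
begin

text \<open>
  \<^const>\<open>residue_ring\<close> has carrier \<open>{0..N - 1}\<close>. Vectors over it are extensional functions on
  the index set \<open>{..<d}\<close>, so that equality of functions is equality of vectors.
\<close>

abbreviation ZN :: "nat \<Rightarrow> int ring"
  where "ZN N \<equiv> residue_ring (int N)"

definition ZN_vec :: "nat \<Rightarrow> nat \<Rightarrow> (nat \<Rightarrow> int) set"
  where "ZN_vec N d = {..<d} \<rightarrow>\<^sub>E carrier (ZN N)"

definition vec_add :: "nat \<Rightarrow> nat \<Rightarrow> (nat \<Rightarrow> int) \<Rightarrow> (nat \<Rightarrow> int) \<Rightarrow> nat \<Rightarrow> int"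
  where "vec_add N d x y = (\<lambda>i\<in>{..<d}. x i \<oplus>\<^bsub>ZN N\<^esub> y i)"

definition vec_dot :: "nat \<Rightarrow> nat \<Rightarrow> (nat \<Rightarrow> int) \<Rightarrow> (nat \<Rightarrow> int) \<Rightarrow> int"
  where "vec_dot N d x y = (\<Oplus>\<^bsub>ZN N\<^esub>i\<in>{..<d}. x i \<otimes>\<^bsub>ZN N\<^esub> y i)"

definition add_char :: "nat \<Rightarrow> int \<Rightarrow> complex"
  where "add_char N t = exp (2 * of_real pi * \<i> * of_int t / of_nat N)"

definition dft :: "nat \<Rightarrow> nat \<Rightarrow> ((nat \<Rightarrow> int) \<Rightarrow> complex) \<Rightarrow> (nat \<Rightarrow> int) \<Rightarrow> complex"
  where "dft N d f m =
    1 / of_nat N ^ d * (\<Sum>x\<in>ZN_vec N d. add_char N (\<ominus>\<^bsub>ZN N\<^esub> vec_dot N d x m) * f x)"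

text \<open>Functions on \<open>ZN_vec N d\<close> are total HOL functions; their values elsewhere are irrelevant.\<close>

definition supported_in ::
    "nat \<Rightarrow> nat \<Rightarrow> ((nat \<Rightarrow> int) \<Rightarrow> complex) \<Rightarrow> (nat \<Rightarrow> int) set \<Rightarrow> bool"
  where "supported_in N d f A \<longleftrightarrow> (\<forall>x\<in>ZN_vec N d. x \<notin> A \<longrightarrow> f x = 0)"

definition add_energy :: "nat \<Rightarrow> nat \<Rightarrow> (nat \<Rightarrow> int) set \<Rightarrow> nat"
  where "add_energy N d A = card {(x1, x2, x3, x4).
    x1 \<in> A \<and> x2 \<in> A \<and> x3 \<in> A \<and> x4 \<in> A \<and> vec_add N d x1 x2 = vec_add N d x3 x4}"

end

theory Submission
  imports Defs "HOL-Analysis.Complex_Transcendental"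
begin

text \<open>
  Put \<open>M = N^(- d) \<Sum>\<bar>f\<bar>\<close>, a bound for \<open>\<bar>dft f\<bar>\<close>. Expanding the fourth power and using orthogonality of
  characters, each piece \<open>f\<^sub>i\<close> of \<open>f\<close> with spectrum in \<open>S\<^sub>i\<close> satisfies
  \<open>\<Sum>\<bar>f\<^sub>i\<bar>^4 \<le> N^d M^4 \<Lambda>(S\<^sub>i)\<close>, so the power mean inequality gives
  \<open>\<Sum>\<bar>f\<bar>^4 \<le> n^3 N^d M^4 \<Sum>\<Lambda>(S\<^sub>i)\<close>. On the other hand Hoelder's inequality on \<open>E\<close> gives
  \<open>N^(4 d) M^4 \<le> \<bar>E\<bar>^3 \<Sum>\<bar>f\<bar>^4\<close>. Together these yield
  \<open>N^(3 d) \<le> \<bar>E\<bar>^3 n^3 \<Sum>\<Lambda>(S\<^sub>i)\<close>, which is stronger than the claim. The second half is the same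
  argument with the roles of \<open>f\<close> and its transform exchanged by Fourier inversion.
\<close>

section \<open>A power mean inequality\<close>

lemma sum_power4_le:
  fixes a :: "'a \<Rightarrow> real"
  shows "(\<Sum>i\<in>I. a i) ^ 4 \<le> real (card I) ^ 3 * (\<Sum>i\<in>I. a i ^ 4)"
proof -
  \<comment> \<open>Cauchy-Schwarz against the constant 1, applied below twice: first to
    \<open>a\<close>, then to its squares.\<close>
  have cs: "(\<Sum>i\<in>I. b i)\<^sup>2 \<le> real (card I) * (\<Sum>i\<in>I. (b i)\<^sup>2)" for b :: "'a \<Rightarrow> real"
    using Cauchy_Schwarz_ineq_sum[of "\<lambda>_. 1" b I] by simp
  have "(\<Sum>i\<in>I. a i) ^ 4 = ((\<Sum>i\<in>I. a i)\<^sup>2)\<^sup>2"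
    by simp
  also have "\<dots> \<le> (real (card I) * (\<Sum>i\<in>I. (a i)\<^sup>2))\<^sup>2"
    by (intro power_mono cs) simp
  also have "\<dots> = real (card I) ^ 2 * (\<Sum>i\<in>I. (a i)\<^sup>2)\<^sup>2"
    by (simp add: power_mult_distrib)
  also have "\<dots> \<le> real (card I) ^ 2 * (real (card I) * (\<Sum>i\<in>I. ((a i)\<^sup>2)\<^sup>2))"
    by (intro mult_left_mono cs) simp
  finally show ?thesis
    by (simp add: power2_eq_square power3_eq_cube power4_eq_xxxx mult.assoc)
qed

section \<open>Additive characters modulo N\<close>

lemma add_char_cis: "add_char N t = cis (2 * pi * of_int t / of_nat N)"
  by (simp add: add_char_def cis_conv_exp mult_ac)

lemma add_char_0 [simp]: "add_char N 0 = 1"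
  by (simp add: add_char_def)

lemma add_char_add: "add_char N (s + t) = add_char N s * add_char N t"
  by (simp add: add_char_cis cis_mult ring_distribs add_divide_distrib)

lemma add_char_sum: "add_char N (\<Sum>i\<in>I. z i) = (\<Prod>i\<in>I. add_char N (z i))"
  by (induction I rule: infinite_finite_induct) (simp_all add: add_char_add)

lemma add_char_minus: "add_char N (- t) = cnj (add_char N t)"
  by (simp add: add_char_cis cis_cnj)

lemma norm_add_char [simp]: "norm (add_char N t) = 1"
  by (simp add: add_char_cis)

lemma add_char_eq_1_iff:
  assumes "N > 0"
  shows "add_char N t = 1 \<longleftrightarrow> int N dvd t"
proof -
  have "add_char N t = 1 \<longleftrightarrow> (\<exists>k::int. 2 * pi * of_int t / of_nat N = of_int (2 * k) * pi)"
    unfolding add_char_def exp_eq_1 by auto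
  also have "\<dots> \<longleftrightarrow> (\<exists>k::int. (of_int t::real) = of_int (int N * k))"
    using assms by (intro ex_cong1) (auto simp: field_simps)
  also have "\<dots> \<longleftrightarrow> int N dvd t"
    unfolding of_int_eq_iff dvd_def ..
  finally show ?thesis .
qed

lemma add_char_cong:
  assumes "N > 0" and "[s = t] (mod int N)"
  shows "add_char N s = add_char N t"
proof -
  have "add_char N (s - t) = 1"
    using assms by (simp add: add_char_eq_1_iff cong_iff_dvd_diff)
  then show ?thesis
    using add_char_add[of N "s - t" t] by simp
qed

text \<open>A geometric sum whose ratio \<open>add_char N z\<close> is an N-th root of unity, equal
  to 1 exactly when N divides z.\<close>

lemma sum_add_char:
  assumes "N > 0"
  shows "(\<Sum>t\<in>{0..<int N}. add_char N (z * t)) = (if int N dvd z then of_nat N else 0)"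
proof -
  have pow: "add_char N (z * int k) = add_char N z ^ k" for k
    by (induction k) (simp_all add: ring_distribs add_char_add)
  have "(\<Sum>t\<in>{0..<int N}. add_char N (z * t)) = (\<Sum>k<N. add_char N z ^ k)"
    by (simp flip: pow, rule sum.reindex_bij_witness[of _ int nat]) auto
  moreover have "add_char N z ^ N = 1"
    using assms by (simp flip: pow add: add_char_eq_1_iff)
  ultimately show ?thesis
    using assms by (auto simp: sum_gp_strict add_char_eq_1_iff)
qed

section \<open>Vectors modulo N: orthogonality and Fourier inversion\<close>

lemma ZN_vec_eq: "ZN_vec N d = {..<d} \<rightarrow>\<^sub>E {0..<int N}"
  unfolding ZN_vec_def residue_ring_def by (intro PiE_cong) auto

lemma finite_ZN_vec [simp]: "finite (ZN_vec N d)"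
  by (simp add: ZN_vec_eq finite_PiE)

lemma ZN_vec_eqI:
  assumes "x \<in> ZN_vec N d" "y \<in> ZN_vec N d" "\<And>i. i < d \<Longrightarrow> int N dvd x i - y i"
  shows "x = y"
proof (rule PiE_ext[of _ "{..<d}" "\<lambda>_. {0..<int N}"])
  fix i assume i: "i \<in> {..<d}"
  have "x i \<in> {0..<int N}" "y i \<in> {0..<int N}"
    using assms i by (auto simp: ZN_vec_eq PiE_iff)
  moreover have "x i mod int N = y i mod int N"
    using assms i by (simp add: mod_eq_dvd_iff)
  ultimately show "x i = y i"
    by simp
qed (use assms in \<open>auto simp: ZN_vec_eq\<close>)

text \<open>The character factors over coordinates, so the sum over the box is a product of
  one-dimensional sums. The coefficients z are arbitrary integers, so that unreduced differences of
  vectors can be inserted.\<close>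

lemma sum_char_ZN_vec:
  assumes "N > 0"
  shows "(\<Sum>y\<in>ZN_vec N d. add_char N (\<Sum>i<d. z i * y i)) =
    (if \<forall>i<d. int N dvd z i then of_nat N ^ d else 0)"
proof -
  have "(\<Sum>y\<in>ZN_vec N d. add_char N (\<Sum>i<d. z i * y i)) =
      (\<Prod>i<d. \<Sum>t\<in>{0..<int N}. add_char N (z i * t))"
    by (simp add: ZN_vec_eq add_char_sum prod_sum_PiE)
  also have "\<dots> = (\<Prod>i<d. if int N dvd z i then of_nat N else 0)"
    using assms by (simp add: sum_add_char)
  also have "\<dots> = (if \<forall>i<d. int N dvd z i then of_nat N ^ d else 0)"
    by auto
  finally show ?thesis .
qed

text \<open>The ring sum reduces modulo N at every addition; congruence to the integer sum is all
  that a character sees.\<close>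

lemma vec_dot_cong:
  assumes "N > 1"
  shows "[vec_dot N d x y = (\<Sum>i<d. x i * y i)] (mod int N)"
proof -
  interpret residues "int N" "ZN N"
    using assms by unfold_locales simp_all
  have carr: "x i \<otimes>\<^bsub>ZN N\<^esub> y i \<in> carrier (ZN N)" for i
    using assms by (auto simp: res_carrier_eq res_mult_eq)
  show ?thesis
  proof (induction d)
    case 0
    then show ?case by (simp add: vec_dot_def res_zero_eq)
  next
    case (Suc d)
    have "vec_dot N (Suc d) x y = (x d * y d mod int N + vec_dot N d x y) mod int N"
      unfolding vec_dot_def lessThan_Suc
      by (subst finsum_insert) (use carr in \<open>auto simp: res_add_eq res_mult_eq\<close>)
    also have "[\<dots> = x d * y d + (\<Sum>i<d. x i * y i)] (mod int N)"
      using Suc by (simp add: cong_def mod_simps) (metis mod_add_right_eq)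
    finally show ?case by (simp add: add.commute)
  qed
qed

lemma add_char_vec_dot:
  assumes "N > 1"
  shows "add_char N (vec_dot N d x y) = add_char N (\<Sum>i<d. x i * y i)"
  using add_char_cong[OF _ vec_dot_cong[OF assms]] assms by simp

lemma dft_eq:
  assumes "N > 1"
  shows "dft N d f m =
    1 / of_nat N ^ d * (\<Sum>x\<in>ZN_vec N d. cnj (add_char N (\<Sum>i<d. x i * m i)) * f x)"
proof -
  interpret residues "int N" "ZN N"
    using assms by unfold_locales simp_all
  have "add_char N (\<ominus>\<^bsub>ZN N\<^esub> vec_dot N d x m) = cnj (add_char N (\<Sum>i<d. x i * m i))" for x
  proof -
    have "add_char N (\<ominus>\<^bsub>ZN N\<^esub> vec_dot N d x m) = add_char N (- vec_dot N d x m)"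
      using assms by (intro add_char_cong) (simp_all add: res_neg_eq)
    then show ?thesis
      by (simp add: add_char_minus add_char_vec_dot[OF assms])
  qed
  then show ?thesis
    by (simp add: dft_def)
qed

lemma fourier_inversion:
  assumes "N > 1" and "x \<in> ZN_vec N d"
  shows "(\<Sum>m\<in>ZN_vec N d. add_char N (\<Sum>i<d. x i * m i) * dft N d f m) = f x"
proof -
  let ?V = "ZN_vec N d"
  have char: "add_char N (\<Sum>i<d. x i * m i) * cnj (add_char N (\<Sum>i<d. u i * m i)) =
      add_char N (\<Sum>i<d. (x i - u i) * m i)" for u m
    by (simp flip: add_char_minus add_char_add add: left_diff_distrib sum_subtractf)
  have *: "add_char N (\<Sum>i<d. x i * m i) * (1 / of_nat N ^ d *
        (cnj (add_char N (\<Sum>i<d. u i * m i)) * f u)) =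
      1 / of_nat N ^ d * (f u * add_char N (\<Sum>i<d. (x i - u i) * m i))" for u m
    by (subst char[symmetric]) (simp only: mult_ac)
  have "(\<Sum>m\<in>?V. add_char N (\<Sum>i<d. x i * m i) * dft N d f m) =
      1 / of_nat N ^ d * (\<Sum>m\<in>?V. \<Sum>u\<in>?V. f u * add_char N (\<Sum>i<d. (x i - u i) * m i))"
    unfolding dft_eq[OF assms(1)] sum_distrib_left * ..
  also have "\<dots> = 1 / of_nat N ^ d *
      (\<Sum>u\<in>?V. f u * (\<Sum>m\<in>?V. add_char N (\<Sum>i<d. (x i - u i) * m i)))"
    by (subst sum.swap) (simp add: sum_distrib_left)
  \<comment> \<open>Orthogonality in m: the inner sum survives only if N divides every
    \<open>x i - u i\<close>, which for reduced entries means u = x.\<close>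
  also have "\<dots> = 1 / of_nat N ^ d * (\<Sum>u\<in>?V. if u = x then f u * of_nat N ^ d else 0)"
    using assms ZN_vec_eqI[of x N d]
    by (intro arg_cong2[of _ _ _ _ "(*)"] sum.cong refl) (auto simp: sum_char_ZN_vec)
  also have "\<dots> = f x"
    using assms by simp
  finally show ?thesis .
qed

section \<open>Additive energy and the uncertainty inequality\<close>

lemma vec_add_eqI:
  assumes "N > 1" and "\<And>i. i < d \<Longrightarrow> int N dvd x1 i + x2 i - x3 i - x4 i"
  shows "vec_add N d x1 x2 = vec_add N d x3 x4"
proof -
  interpret residues "int N" "ZN N"
    using assms by unfold_locales simp_all
  have "(x1 i + x2 i) mod int N = (x3 i + x4 i) mod int N" if "i < d" for i
    using assms(2)[OF that] by (simp add: mod_eq_dvd_iff algebra_simps)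
  then show ?thesis
    by (auto simp: vec_add_def res_add_eq intro!: restrict_ext)
qed

text \<open>The fourth power of the norm is a sum over quadruples from A. Summing over y removes
  those with x1 + x2 \<noteq> x3 + x4; each of the others, counted by the energy, contributes at
  most N^d M^4.\<close>

lemma fourth_moment_le:
  fixes h :: "(nat \<Rightarrow> int) \<Rightarrow> complex"
  assumes N: "N > 1" and A: "A \<subseteq> ZN_vec N d" and h: "\<And>x. x \<in> A \<Longrightarrow> norm (h x) \<le> M"
  shows "(\<Sum>y\<in>ZN_vec N d. norm (\<Sum>x\<in>A. add_char N (\<Sum>i<d. x i * y i) * h x) ^ 4) \<le>
    real N ^ d * M ^ 4 * real (add_energy N d A)"
proof -
  let ?V = "ZN_vec N d"
  have fin: "finite A"
    using A finite_subset by fastforce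
  define c where "c x y = add_char N (\<Sum>i<d. x i * y i)" for x y :: "nat \<Rightarrow> int"
  define T where "T y = (\<Sum>x\<in>A. c x y * h x)" for y
  define H where "H = (\<lambda>(x1, x2, x3, x4). h x1 * h x2 * cnj (h x3) * cnj (h x4))"
  define K where "K = (\<lambda>(x1, x2, x3, x4) y.
    add_char N (\<Sum>i<d. (x1 i + x2 i - x3 i - x4 i) * y i))"
  define Q where "Q = {(x1, x2, x3, x4). x1 \<in> A \<and> x2 \<in> A \<and> x3 \<in> A \<and> x4 \<in> A \<and>
    vec_add N d x1 x2 = vec_add N d x3 x4}"
  let ?A4 = "A \<times> A \<times> A \<times> A"
  have finQ: "finite ?A4" and QA: "Q \<subseteq> ?A4"
    using fin by (auto simp: Q_def)
  have K: "K (x1, x2, x3, x4) y = c x1 y * c x2 y * cnj (c x3 y) * cnj (c x4 y)" for x1 x2 x3 x4 y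
    by (simp add: K_def c_def flip: add_char_minus add_char_add)
      (simp add: ring_distribs sum.distrib sum_subtractf)
  have sq: "(of_real (norm z))\<^sup>2 = z * cnj z" for z
    by (metis complex_norm_square of_real_power)
  have T: "of_real (norm (T y) ^ 4) = (\<Sum>q\<in>?A4. H q * K q y)" for y
  proof -
    have "of_real (norm (T y) ^ 4) = (of_real (norm (T y)))\<^sup>2 * (of_real (norm (T y)) :: complex)\<^sup>2"
      by (simp flip: power_add)
    also have "\<dots> = T y * (T y * (cnj (T y) * cnj (T y)))"
      by (simp only: sq mult_ac)
    also have "\<dots> = (\<Sum>q\<in>?A4. H q * K q y)"
      by (auto simp: T_def cnj_sum sum_product sum.cartesian_product H_def K intro!: sum.cong)
    finally show ?thesis .
  qed
  \<comment> \<open>An upper bound suffices: if the sum is nonzero, N divides every coordinate of x1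
    + x2 - x3 - x4, so \<open>q\<close> lies in \<open>Q\<close>.\<close>
  have orth: "norm (\<Sum>y\<in>?V. K q y) \<le> (if q \<in> Q then real N ^ d else 0)" if "q \<in> ?A4" for q
  proof -
    obtain x1 x2 x3 x4 where q: "q = (x1, x2, x3, x4)"
      by (cases q)
    show ?thesis
      using N that vec_add_eqI[of N d x1 x2 x3 x4]
      by (auto simp: q K_def Q_def sum_char_ZN_vec norm_power)
  qed
  have H: "norm (H q) \<le> M ^ 4" if mem: "q \<in> ?A4" for q
  proof -
    obtain x1 x2 x3 x4 where q: "q = (x1, x2, x3, x4)" "x1 \<in> A" "x2 \<in> A" "x3 \<in> A" "x4 \<in> A"
      using mem by (cases q) auto
    \<comment> \<open>The sign of M comes from the bound at a point of A, available because
      \<open>q\<close> supplies one.\<close>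
    have "0 \<le> M"
      using norm_ge_zero h[OF q(2)] by (rule order_trans)
    then have "norm (H q) \<le> M * M * M * M"
      using q(2-5) by (auto simp: q(1) H_def norm_mult intro!: mult_mono h)
    then show ?thesis
      by (simp add: power4_eq_xxxx)
  qed
  have "(\<Sum>y\<in>?V. norm (T y) ^ 4) = norm (of_real (\<Sum>y\<in>?V. norm (T y) ^ 4) :: complex)"
    by (simp add: sum_nonneg del: of_real_sum)
  also have "\<dots> = norm (\<Sum>q\<in>?A4. H q * (\<Sum>y\<in>?V. K q y))"
    unfolding of_real_sum T by (subst sum.swap) (simp add: sum_distrib_left)
  also have "\<dots> \<le> (\<Sum>q\<in>?A4. M ^ 4 * (if q \<in> Q then real N ^ d else 0))"
    by (intro sum_norm_le) (auto simp only: norm_mult intro!: mult_mono H orth zero_le_even_power norm_ge_zero; simp)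
  also have "\<dots> = real N ^ d * M ^ 4 * real (card Q)"
    using finQ QA by (simp add: sum.If_cases if_distrib Int_absorb1 cong: if_cong)
  finally show ?thesis
    by (simp add: T_def c_def Q_def add_energy_def)
qed

text \<open>F and G are abstract so that both halves are instances: f with its transform, and N^d
  times the transform with the conjugate of f. Relating F to G only through norms leaves room for
  that conjugation.\<close>

lemma uncertainty_add_energy:
  fixes F G :: "(nat \<Rightarrow> int) \<Rightarrow> complex" and n :: nat
  assumes N: "N > 1" and B: "B \<subseteq> ZN_vec N d" and A: "A \<subseteq> ZN_vec N d"
    and disj: "disjoint_family_on Ai {1..n}" and AU: "A = (\<Union>i\<in>{1..n}. Ai i)"
    and F: "\<And>x. x \<in> ZN_vec N d \<Longrightarrow>
      norm (F x) = norm (\<Sum>m\<in>A. add_char N (\<Sum>i<d. m i * x i) * G m)"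
    and G: "\<And>m. m \<in> A \<Longrightarrow> real N ^ d * norm (G m) \<le> (\<Sum>x\<in>B. norm (F x))"
    and nz: "\<exists>x\<in>B. F x \<noteq> 0"
  shows "N ^ d \<le> card B * n ^ 3 * (\<Sum>i = 1..n. add_energy N d (Ai i))"
proof -
  let ?V = "ZN_vec N d"
  define L where "L = (\<Sum>i = 1..n. add_energy N d (Ai i))"
  define s where "s = (\<Sum>x\<in>B. norm (F x))"
  define P where "P = (\<Sum>x\<in>B. norm (F x) ^ 4)"
  define M where "M = s / real N ^ d"
  define g where "g i x = (\<Sum>m\<in>Ai i. add_char N (\<Sum>j<d. m j * x j) * G m)" for i x
  have finB: "finite B" and finA: "finite A"
    using A B finite_subset by fastforce+
  have GM: "norm (G m) \<le> M" if "m \<in> A" for m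
    using G[OF that] N by (simp add: M_def s_def field_simps)
  have Fle: "norm (F x) ^ 4 \<le> real n ^ 3 * (\<Sum>i=1..n. norm (g i x) ^ 4)" if "x \<in> ?V" for x
  proof -
    have "norm (F x) = norm (\<Sum>i=1..n. g i x)"
      unfolding F[OF that] g_def AU
      using disj finA AU by (subst sum.UNION_disjoint) (auto simp: disjoint_family_on_def)
    also have "\<dots> \<le> (\<Sum>i=1..n. norm (g i x))"
      by (rule norm_sum)
    finally have "norm (F x) ^ 4 \<le> (\<Sum>i=1..n. norm (g i x)) ^ 4"
      by (intro power_mono) auto
    also have "\<dots> \<le> real n ^ 3 * (\<Sum>i=1..n. norm (g i x) ^ 4)"
      using sum_power4_le[of "\<lambda>i. norm (g i x)" "{1..n}"] by simp
    finally show ?thesis .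
  qed
  have moment: "(\<Sum>x\<in>?V. norm (g i x) ^ 4) \<le> real N ^ d * M ^ 4 * real (add_energy N d (Ai i))"
    if "i \<in> {1..n}" for i
  proof -
    have Ai: "Ai i \<subseteq> A"
      using that AU by blast
    show ?thesis
      unfolding g_def by (rule fourth_moment_le[OF N]) (use Ai A GM in blast)+
  qed
  \<comment> \<open>The sum over B is enlarged to all vectors, where the fourth moment bound
    applies.\<close>
  have "P \<le> (\<Sum>x\<in>?V. norm (F x) ^ 4)"
    unfolding P_def using B by (intro sum_mono2) auto
  also have "\<dots> \<le> (\<Sum>x\<in>?V. real n ^ 3 * (\<Sum>i=1..n. norm (g i x) ^ 4))"
    by (intro sum_mono Fle)
  also have "\<dots> = real n ^ 3 * (\<Sum>i=1..n. \<Sum>x\<in>?V. norm (g i x) ^ 4)"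
    by (subst sum.swap) (simp add: sum_distrib_left)
  also have "\<dots> \<le> real n ^ 3 * (\<Sum>i=1..n. real N ^ d * M ^ 4 * real (add_energy N d (Ai i)))"
    using moment by (intro mult_left_mono sum_mono) simp_all
  also have "\<dots> = real n ^ 3 * (real N ^ d * M ^ 4 * real L)"
    by (simp add: L_def sum_distrib_left)
  finally have P_le: "P \<le> real n ^ 3 * (real N ^ d * M ^ 4 * real L)" .
  have s_le: "s ^ 4 \<le> real (card B) ^ 3 * P"
    unfolding s_def P_def by (rule sum_power4_le)
  have "s > 0"
    unfolding s_def using nz finB by (auto intro: sum_pos2)
  \<comment> \<open>The factor N^(3 d) completes N^d M^4 to (N^d M)^4 = s^4, which then cancels
    because s > 0.\<close>
  have "real N ^ (3 * d) * s ^ 4 \<le>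
      real N ^ (3 * d) * (real (card B) ^ 3 * (real n ^ 3 * (real N ^ d * M ^ 4 * real L)))"
    using s_le P_le by (meson mult_left_mono order_trans zero_le_power of_nat_0_le_iff)
  also have "\<dots> = (real (card B) ^ 3 * real n ^ 3 * real L) * (real N ^ d * M) ^ 4"
    by (simp add: power_mult_distrib flip: power_mult power_add)
      (simp add: algebra_simps flip: power_add)
  also have "real N ^ d * M = s"
    using N by (simp add: M_def)
  finally have "real (N ^ (3 * d)) \<le> real (card B ^ 3 * (n ^ 3 * L))"
    using \<open>s > 0\<close> by (simp add: mult.assoc)
  then have "N ^ (3 * d) \<le> card B ^ 3 * (n ^ 3 * L)"
    by (simp only: of_nat_le_iff)
  \<comment> \<open>For a natural number k, k \<le> k^3, with k = 0 treated separately; now both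
    sides are cubes and roots can be taken.\<close>
  also have "\<dots> \<le> card B ^ 3 * (n ^ 3 * L) ^ 3"
    by (intro mult_left_mono) (cases "n ^ 3 * L", auto intro: self_le_power)
  finally have "(N ^ d) ^ 3 \<le> (card B * (n ^ 3 * L)) ^ 3"
    by (simp add: power_mult_distrib mult.commute flip: power_mult)
  then show ?thesis
    by (simp add: L_def power_mono_iff mult.assoc)
qed

theorem theorem1p14:
  fixes N d :: nat
    and f :: "(nat \<Rightarrow> int) \<Rightarrow> complex"
    and E S :: "(nat \<Rightarrow> int) set"
  assumes "N \<ge> 2" and "d \<ge> 1"
    and "E \<subseteq> ZN_vec N d" and "S \<subseteq> ZN_vec N d"
    and "\<exists>x\<in>ZN_vec N d. f x \<noteq> 0"
    and "supported_in N d f E"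
    and "supported_in N d (dft N d f) S"
  shows "(\<forall>(n::nat) Si. disjoint_family_on Si {1..n} \<and> S = (\<Union>i\<in>{1..n}. Si i) \<longrightarrow>
            card E * n ^ 3 * (\<Sum>i = 1..n. add_energy N d (Si i)) \<ge> N ^ d) \<and>
         (\<forall>(m::nat) Ei. disjoint_family_on Ei {1..m} \<and> E = (\<Union>i\<in>{1..m}. Ei i) \<longrightarrow>
            card S * m ^ 3 * (\<Sum>i = 1..m. add_energy N d (Ei i)) \<ge> N ^ d)"
proof -
  let ?V = "ZN_vec N d"
  let ?g = "dft N d f"
  define e where "e x m = add_char N (\<Sum>i<d. m i * x i)" for x m :: "nat \<Rightarrow> int"
  have e_comm: "add_char N (\<Sum>i<d. x i * m i) = e x m" for x m
    by (simp add: e_def mult.commute)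
  have N: "N > 1" "N > 0"
    using assms by auto
  have norm_e: "norm (e x m) = 1" for x m
    by (simp add: e_def)
  have zero_f: "f x = 0" if "x \<in> ?V - E" for x
    using assms that by (auto simp: supported_in_def)
  have zero_g: "?g m = 0" if "m \<in> ?V - S" for m
    using assms that by (auto simp: supported_in_def)
  have f_eq: "f x = (\<Sum>m\<in>S. e x m * ?g m)" if "x \<in> ?V" for x
  proof -
    have "f x = (\<Sum>m\<in>?V. e x m * ?g m)"
      using fourier_inversion[OF N(1) that, of f] by (simp add: e_comm)
    also have "\<dots> = (\<Sum>m\<in>S. e x m * ?g m)"
      using assms zero_g by (intro sum.mono_neutral_right) auto
    finally show ?thesis .
  qed
  have g_eq: "of_nat N ^ d * ?g m = (\<Sum>x\<in>E. cnj (e x m) * f x)" for m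
  proof -
    have "of_nat N ^ d * ?g m = (\<Sum>x\<in>?V. cnj (e x m) * f x)"
      using N by (simp add: dft_eq e_comm)
    also have "\<dots> = (\<Sum>x\<in>E. cnj (e x m) * f x)"
      using assms zero_f by (intro sum.mono_neutral_right) auto
    finally show ?thesis .
  qed
  have nz_f: "\<exists>x\<in>E. f x \<noteq> 0"
    using assms zero_f by auto
  \<comment> \<open>If the transform vanished on S, inversion would make f zero everywhere.\<close>
  have nz_g: "\<exists>m\<in>S. of_nat N ^ d * ?g m \<noteq> 0"
  proof (rule ccontr)
    assume "\<not> ?thesis"
    then have "\<forall>m\<in>S. ?g m = 0"
      using N by auto
    then show False
      using assms(5) f_eq by auto
  qed
  show ?thesis
  proof (intro conjI allI impI; elim conjE)
    fix n Si
    assume S: "disjoint_family_on Si {1..n::nat}" "S = (\<Union>i\<in>{1..n}. Si i)"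
    show "N ^ d \<le> card E * n ^ 3 * (\<Sum>i = 1..n. add_energy N d (Si i))"
    proof (rule uncertainty_add_energy[OF N(1) assms(3,4) S _ _ nz_f])
      fix m
      have "real N ^ d * norm (?g m) = norm (\<Sum>x\<in>E. cnj (e x m) * f x)"
        by (simp flip: g_eq add: norm_mult norm_power)
      also have "\<dots> \<le> (\<Sum>x\<in>E. norm (f x))"
        by (intro sum_norm_le) (simp add: norm_mult norm_e)
      finally show "real N ^ d * norm (?g m) \<le> (\<Sum>x\<in>E. norm (f x))" .
    qed (use f_eq in \<open>auto simp: e_def\<close>)
  next
    fix n Ei
    assume E: "disjoint_family_on Ei {1..n::nat}" "E = (\<Union>i\<in>{1..n}. Ei i)"
    show "N ^ d \<le> card S * n ^ 3 * (\<Sum>i = 1..n. add_energy N d (Ei i))"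
    \<comment> \<open>The forward transform carries conjugated characters. Conjugating the whole sum
      turns them into \<open>e x m\<close> and f into \<open>cnj (f x)\<close> without changing
      norms; scaling by N^d absorbs the normalisation of \<open>dft\<close>.\<close>
    proof (rule uncertainty_add_energy[OF N(1) assms(4,3) E _ _ nz_g, of "\<lambda>x. cnj (f x)"])
      fix m
      have "cnj (of_nat N ^ d * ?g m) = (\<Sum>x\<in>E. e x m * cnj (f x))"
        unfolding g_eq by simp
      then show "norm (of_nat N ^ d * ?g m) =
          norm (\<Sum>x\<in>E. add_char N (\<Sum>i<d. x i * m i) * cnj (f x))"
        unfolding e_comm by (metis complex_mod_cnj)
    next
      fix x assume "x \<in> E"
      then have "norm (f x) \<le> (\<Sum>m\<in>S. norm (?g m))"
        using assms by (subst f_eq) (auto intro!: sum_norm_le simp: norm_mult norm_e)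
      then show "real N ^ d * norm (cnj (f x)) \<le> (\<Sum>m\<in>S. norm (of_nat N ^ d * ?g m))"
        by (simp add: norm_mult norm_power mult_left_mono flip: sum_distrib_left)
    qed
  qed
qed

end
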